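(* Let $k_\mathcal{G}=n_\mathcal{G}-1\ge 1$, $n_\mathcal{H}=3$ and $k_\mathcal{H}=2$. Let $s_0=\alpha+\beta\sum_{g\in V(\mathcal{G})}\sum_{h\in V(\mathcal{H})}x_{gh}+\gamma\sum_{g\in V(\mathcal{G})}\sum_{\{h,h'\}\subseteq V(\mathcal{H})}x_{gh}x_{gh'}$ and, for $g\in V(\mathcal{G})$, $s_g=\frac13\big(\sum_{h\in V(\mathcal{H})}x_{gh}-2\sum_{\{h,h'\}\subseteq V(\mathcal{H})}x_{gh}x_{gh'}\big)$, where $\alpha=\sqrt2(n_\mathcal{G}-1)$, $\beta=-\frac23\sqrt2$, $\gamma=\frac13\sqrt2$. Then $f_{\mathrm{viz}}\equiv s_0^2+\sum_{g\in V(\mathcal{G})}s_g^2\pmod{I_{\mathrm{viz}}}$, i.e. these polynomials form a degree-2 sum-of-squares certificate of $f_{\mathrm{viz}}$; consequently $\gamma(G)\gamma(H)\le\gamma(G\Box H)$ whenever $G$ has $n_\mathcal{G}$ vertices and domination number $n_\mathcal{G}-1$ and $H$ has $3$ vertices and domination number $2$.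
   Context: $\mathbb{K}$ is a subfield of $\mathbb{R}$ containing $\sqrt2$ (e.g. $\mathbb{K}=\mathbb{R}$). $V(\mathcal{G})$ is a set of $n_\mathcal{G}$ vertices with fixed subset $D_\mathcal{G}$ of size $k_\mathcal{G}$; $V(\mathcal{H})$ a disjoint set of $n_\mathcal{H}$ vertices with fixed subset $D_\mathcal{H}$ of size $k_\mathcal{H}$. Variables $e_{gg'}=e_{g'g}$ for 2-subsets of $V(\mathcal{G})$, $e_{hh'}$ for 2-subsets of $V(\mathcal{H})$, $x_{gh}$ for $g\in V(\mathcal{G}),h\in V(\mathcal{H})$; $P$ is the polynomial ring over $\mathbb{K}$ in these. $I_{\mathrm{viz}}\subseteq P$ is generated by: $e_{gg'}^2-e_{gg'}$; $\prod_{g'\in D_\mathcal{G}}(1-e_{gg'})$ for $g\in V(\mathcal{G})\setminus D_\mathcal{G}$; $\prod_{g'\in V(\mathcal{G})\setminus S}\sum_{g\in S}e_{gg'}$ for $S\subseteq V(\mathcal{G})$ with $|S|=k_\mathcal{G}-1$; the same three families for $\mathcal{H}$ (with $V(\mathcal{H}),D_\mathcal{H},k_\mathcal{H}$); $x_{gh}^2-x_{gh}$; and $(1-x_{gh})\prod_{g'\in V(\mathcal{G}),g'\ne g}(1-e_{gg'}x_{g'h})\prod_{h'\in V(\mathcal{H}),h'\ne h}(1-e_{hh'}x_{gh'})$ for all $g,h$. $f_{\mathrm{viz}}=\sum_{g,h}x_{gh}-k_\mathcal{G}k_\mathcal{H}$. $a\equiv b\pmod I$ means $a-b\in I$. $\gamma(\cdot)$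 is the domination number and $G\Box H$ the Cartesian product graph. *)

theory Defs
  imports
    Complex_Main
    "HOL-Library.Poly_Mapping"
    "HOL-Algebra.Algebraic_Closure_Type"
begin

section \<open>Polynomial rings over a subfield of the reals\<close>

text \<open>
  A monomial is a finitely supported exponent function, and a polynomial a finitely supported
  coefficient function on monomials. The type provides all variables of \<open>'v\<close> and all
  real coefficients; \<open>mpoly_ring K U\<close> cuts out \<open>K[U]\<close>.
\<close>

type_synonym 'v mpoly = "('v \<Rightarrow>\<^sub>0 nat) \<Rightarrow>\<^sub>0 real"

definition Var :: "'v \<Rightarrow> 'v mpoly" where
  "Var v = Poly_Mapping.single (Poly_Mapping.single v 1) 1"

definition Const :: "real \<Rightarrow> 'v mpoly" where
  "Const c = Poly_Mapping.single 0 c"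

definition mpoly_ring :: "real set \<Rightarrow> 'v set \<Rightarrow> 'v mpoly ring" where
  "mpoly_ring K U = (ring_of_type_algebra :: 'v mpoly ring)
     \<lparr>carrier := {p. (\<forall>m. Poly_Mapping.lookup p m \<in> K) \<and>
                    (\<forall>m \<in> Poly_Mapping.keys p. Poly_Mapping.keys m \<subseteq> U)}\<rparr>"

text \<open>The zero polynomial gets total degree \<open>0\<close>.\<close>

definition total_degree :: "'v mpoly \<Rightarrow> nat" where
  "total_degree p = Max (insert 0
     ((\<lambda>m. \<Sum>v \<in> Poly_Mapping.keys m. Poly_Mapping.lookup m v) ` Poly_Mapping.keys p))"

definition cong_mod :: "'v mpoly \<Rightarrow> 'v mpoly \<Rightarrow> 'v mpoly set \<Rightarrow> bool" where
  "cong_mod a b I \<longleftrightarrow> a - b \<in> I"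

text \<open>
  The degree \<open>l\<close> of a certificate bounds the degrees of the \<open>s i\<close>, not those of their squares.
\<close>

definition sos_certificate ::
  "'v mpoly ring \<Rightarrow> 'v mpoly set \<Rightarrow> nat \<Rightarrow> 'v mpoly \<Rightarrow> 'i set \<Rightarrow> ('i \<Rightarrow> 'v mpoly) \<Rightarrow> bool" where
  "sos_certificate R I l f J s \<longleftrightarrow>
     finite J \<and> (\<forall>i\<in>J. s i \<in> carrier R \<and> total_degree (s i) \<le> l) \<and>
     cong_mod f (\<Sum>i\<in>J. (s i)\<^sup>2) I"


section \<open>The Vizing ideal\<close>

text \<open>
  Edge variables are indexed by sets of vertices, so that the variables for \<open>(g, g')\<close>
  and \<open>(g', g)\<close> coincide by construction;
  \<open>viz_vars\<close> admits only sets with exactly two elements. Disjointness of the two vertex sets is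
  expressed by giving them separate types.
\<close>

datatype ('g, 'h) viz_var = EG "'g set" | EH "'h set" | XV 'g 'h

definition viz_vars :: "'g set \<Rightarrow> 'h set \<Rightarrow> ('g, 'h) viz_var set" where
  "viz_vars VG VH =
     {EG e | e. e \<subseteq> VG \<and> card e = 2} \<union>
     {EH e | e. e \<subseteq> VH \<and> card e = 2} \<union>
     {XV g h | g h. g \<in> VG \<and> h \<in> VH}"

definition viz_ring :: "real set \<Rightarrow> 'g set \<Rightarrow> 'h set \<Rightarrow> ('g, 'h) viz_var mpoly ring" where
  "viz_ring K VG VH = mpoly_ring K (viz_vars VG VH)"

text \<open>
  The generators describing graphs on \<open>V\<close> with minimum dominating set \<open>D\<close>, where
  \<open>e u v\<close> is the polynomial variable of the edge between \<open>u\<close> and \<open>v\<close>.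
\<close>

definition graph_gens :: "('a \<Rightarrow> 'a \<Rightarrow> 'v mpoly) \<Rightarrow> 'a set \<Rightarrow> 'a set \<Rightarrow> 'v mpoly set" where
  "graph_gens e V D =
     {(e u v)\<^sup>2 - e u v | u v. u \<in> V \<and> v \<in> V \<and> u \<noteq> v} \<union>
     {\<Prod>v\<in>D. (1 - e u v) | u. u \<in> V - D} \<union>
     {\<Prod>v\<in>V - S. \<Sum>u\<in>S. e u v | S. S \<subseteq> V \<and> card S = card D - 1}"

abbreviation eG :: "'g \<Rightarrow> 'g \<Rightarrow> ('g, 'h) viz_var mpoly" where
  "eG g g' \<equiv> Var (EG {g, g'})"

abbreviation eH :: "'h \<Rightarrow> 'h \<Rightarrow> ('g, 'h) viz_var mpoly" where
  "eH h h' \<equiv> Var (EH {h, h'})"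

abbreviation xv :: "'g \<Rightarrow> 'h \<Rightarrow> ('g, 'h) viz_var mpoly" where
  "xv g h \<equiv> Var (XV g h)"

definition product_gens :: "'g set \<Rightarrow> 'h set \<Rightarrow> ('g, 'h) viz_var mpoly set" where
  "product_gens VG VH =
     {(xv g h)\<^sup>2 - xv g h | g h. g \<in> VG \<and> h \<in> VH} \<union>
     {(1 - xv g h) * (\<Prod>g' \<in> VG - {g}. (1 - eG g g' * xv g' h))
                  * (\<Prod>h' \<in> VH - {h}. (1 - eH h h' * xv g h')) | g h. g \<in> VG \<and> h \<in> VH}"

definition viz_ideal ::
  "real set \<Rightarrow> 'g set \<Rightarrow> 'g set \<Rightarrow> 'h set \<Rightarrow> 'h set \<Rightarrow> ('g, 'h) viz_var mpoly set" where
  "viz_ideal K VG DG VH DH =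
     genideal (viz_ring K VG VH) (graph_gens eG VG DG \<union> graph_gens eH VH DH \<union> product_gens VG VH)"

definition f_viz ::
  "'g set \<Rightarrow> 'g set \<Rightarrow> 'h set \<Rightarrow> 'h set \<Rightarrow> ('g, 'h) viz_var mpoly" where
  "f_viz VG DG VH DH = (\<Sum>g\<in>VG. \<Sum>h\<in>VH. xv g h) - Const (real (card DG) * real (card DH))"


section \<open>Graphs and domination\<close>

text \<open>Finite simple undirected graphs, as a vertex set together with a set of 2-subsets.\<close>

type_synonym 'a ugraph = "'a set \<times> 'a set set"

abbreviation vertices :: "'a ugraph \<Rightarrow> 'a set" where
  "vertices G \<equiv> fst G"

abbreviation edges :: "'a ugraph \<Rightarrow> 'a set set" where
  "edges G \<equiv> snd G"

definition simple_graph :: "'a ugraph \<Rightarrow> bool" where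
  "simple_graph G \<longleftrightarrow> finite (vertices G) \<and> (\<forall>e \<in> edges G. e \<subseteq> vertices G \<and> card e = 2)"

definition dominating_set :: "'a ugraph \<Rightarrow> 'a set \<Rightarrow> bool" where
  "dominating_set G D \<longleftrightarrow>
     D \<subseteq> vertices G \<and> (\<forall>v \<in> vertices G - D. \<exists>u\<in>D. {u, v} \<in> edges G)"

definition domination_number :: "'a ugraph \<Rightarrow> nat" where
  "domination_number G = Min (card ` {D. dominating_set G D})"

definition cartesian_product :: "'a ugraph \<Rightarrow> 'b ugraph \<Rightarrow> ('a \<times> 'b) ugraph" where
  "cartesian_product G H =
     (vertices G \<times> vertices H,
      {{(g, h), (g, h')} | g h h'. g \<in> vertices G \<and> {h, h'} \<in> edges H} \<union>
      {{(g, h), (g', h)} | g g' h. {g, g'} \<in> edges G \<and> h \<in> vertices H})"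

end

theory Submission
  imports Defs
begin

text \<open>
  Since the ideal contains \<open>w\<^sup>2 - w\<close> for every variable \<open>w\<close>, it suffices to compare both sides of the
  congruence at the Boolean points where all generators vanish: the Lagrange idempotents of the
  cube sum to \<open>1\<close>, and the idempotent of a point at which some generator does not vanish lies in
  the ideal. This also works over a field that is not algebraically closed.

  A graph on \<open>n\<close> vertices with domination number \<open>n - 1\<close> has exactly one edge, so the points of
  the variety are pairs of single-edge graphs with a dominating set of the product. If \<open>g\<close> is isolated,
  the \<open>H\<close>-fibre over \<open>g\<close> contains \<open>t \<in> {2, 3}\<close> chosen vertices and contributes \<open>t - 2\<close> to both sides; the two
  fibres over the edge of \<open>G\<close> leave a finite check on six Boolean values.
\<close>

section \<open>Polynomials over a real subfield\<close>

lemma Const_add: "Const (a + b) = Const a + Const b"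
  by (simp add: Const_def single_add)

lemma Const_mult: "Const (a * b) = Const a * Const b"
  by (simp add: Const_def mult_single)

lemma Const_0 [simp]: "Const 0 = 0"
  by (simp add: Const_def)

lemma Const_1 [simp]: "Const 1 = 1"
  by (simp add: Const_def)

lemma Const_numeral: "Const (numeral n) = numeral n"
proof -
  have "Const (of_nat k) = (of_nat k :: 'v mpoly)" for k
    by (induction k) (simp_all add: Const_add)
  from this[of "numeral n"] show ?thesis by simp
qed

lemma Const_uminus: "Const (- a) = - Const a"
  by (simp add: Const_def single_uminus)

section \<open>Upper bounds for the total degree\<close>

definition monomial_degree :: "('v \<Rightarrow>\<^sub>0 nat) \<Rightarrow> nat" where
  "monomial_degree m = (\<Sum>v \<in> Poly_Mapping.keys m. Poly_Mapping.lookup m v)"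

lemma monomial_degree_add: "monomial_degree (m + n) = monomial_degree m + monomial_degree n"
  unfolding monomial_degree_def by (rule setsum_keys_plus_distrib) simp_all

text \<open>The inserted \<open>0\<close> never exceeds a natural bound, so the maximum turns into
  one condition per monomial. Degrees are only bounded from above, hence cancellation does no
  harm.\<close>

lemma total_degree_le_iff:
  "total_degree p \<le> d \<longleftrightarrow> (\<forall>m \<in> Poly_Mapping.keys p. monomial_degree m \<le> d)"
  by (auto simp: total_degree_def monomial_degree_def)

lemma total_degree_add_le:
  "total_degree p \<le> d \<Longrightarrow> total_degree q \<le> d \<Longrightarrow> total_degree (p + q) \<le> d"
  unfolding total_degree_le_iff using keys_add[of p q] by blast

lemma total_degree_diff_le:
  "total_degree p \<le> d \<Longrightarrow> total_degree q \<le> d \<Longrightarrow> total_degree (p - q) \<le> d"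
  unfolding total_degree_le_iff using keys_diff[of p q] by blast

lemma total_degree_mult_le:
  assumes "total_degree p \<le> d" "total_degree q \<le> d'"
  shows "total_degree (p * q) \<le> d + d'"
  unfolding total_degree_le_iff
proof
  fix m assume "m \<in> Poly_Mapping.keys (p * q)"
  then obtain a b where "m = a + b" "a \<in> Poly_Mapping.keys p" "b \<in> Poly_Mapping.keys q"
    using keys_mult[of p q] by blast
  then show "monomial_degree m \<le> d + d'"
    using assms by (auto simp: total_degree_le_iff monomial_degree_add intro!: add_mono)
qed

lemma total_degree_Const [simp]: "total_degree (Const c) = 0"
proof -
  have "total_degree (Const c) \<le> 0"
    unfolding total_degree_le_iff Const_def by (simp add: monomial_degree_def)
  then show ?thesis by simp
qed

lemma total_degree_Var_le: "total_degree (Var v) \<le> 1"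
  by (simp add: total_degree_le_iff Var_def monomial_degree_def)

lemma total_degree_sum_le:
  "(\<And>i. i \<in> J \<Longrightarrow> total_degree (f i) \<le> d) \<Longrightarrow> total_degree (sum f J) \<le> d"
proof (induction J rule: infinite_finite_induct)
  case (insert i J)
  then show ?case by (simp add: total_degree_add_le)
qed (simp_all add: total_degree_def)

lemma total_degree_prod_le:
  "(\<And>i. i \<in> J \<Longrightarrow> total_degree (f i) \<le> d) \<Longrightarrow> total_degree (prod f J) \<le> card J * d"
proof (induction J rule: infinite_finite_induct)
  case (insert i J)
  then show ?case using total_degree_mult_le[of "f i" d "prod f J" "card J * d"] by simp
qed (simp_all add: total_degree_Const[of 1, simplified])

text \<open>Updating \<open>carrier\<close> leaves the operations of the type untouched; the rules
  carry the ring-theoretic ideal axioms over to ordinary \<open>+\<close> and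
  \<open>*\<close>.\<close>

lemma mpoly_ring_simps:
  "p \<otimes>\<^bsub>mpoly_ring K U\<^esub> q = p * q" "p \<oplus>\<^bsub>mpoly_ring K U\<^esub> q = p + q" "\<zero>\<^bsub>mpoly_ring K U\<^esub> = 0"
  by (simp_all add: mpoly_ring_def ring_of_type_algebra_def)

section \<open>Closure properties of a real subfield and of \<open>K[U]\<close>\<close>

locale real_subfield =
  fixes K :: "real set"
  assumes subfield: "subfield K (ring_of_type_algebra :: real ring)"
begin

lemma zero_mem [simp]: "0 \<in> K"
  and one_mem [simp]: "1 \<in> K"
  and add_mem: "a \<in> K \<Longrightarrow> b \<in> K \<Longrightarrow> a + b \<in> K"
  and mult_mem: "a \<in> K \<Longrightarrow> b \<in> K \<Longrightarrow> a * b \<in> K"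
  using subringE[OF subfieldE(1)[OF subfield]] by (simp_all add: ring_of_type_algebra_def)

text \<open>The subfield supplies some inverse inside \<open>K\<close>, and uniqueness identifies it
  with the real one. The case \<open>a = 0\<close> rests on the convention
  \<open>inverse 0 = 0\<close>.\<close>

lemma inverse_mem:
  assumes "a \<in> K" shows "inverse a \<in> K"
proof (cases "a = 0")
  case False
  interpret R: field "ring_of_type_algebra :: real ring"
    by (rule field_from_type_algebra)
  have "\<exists>b\<in>K. a * b = 1"
    using R.subfield_m_inv[OF subfield, of a] assms False by (auto simp: ring_of_type_algebra_def)
  then show ?thesis by (metis inverse_unique)
qed simp

lemma uminus_mem:
  assumes "a \<in> K" shows "- a \<in> K"
proof -
  interpret R: ring "ring_of_type_algebra :: real ring"
    by (rule ring_from_type_algebra)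
  have "\<ominus>\<^bsub>ring_of_type_algebra\<^esub> a = - a"
    by (rule R.minus_equality) (simp_all add: ring_of_type_algebra_def)
  then show ?thesis
    using subringE(5)[OF subfieldE(1)[OF subfield] assms] by simp
qed

lemma diff_mem: "a \<in> K \<Longrightarrow> b \<in> K \<Longrightarrow> a - b \<in> K"
  using add_mem[of a "- b"] uminus_mem[of b] by simp

lemma of_nat_mem: "of_nat n \<in> K"
  by (induction n) (simp_all add: add_mem)

lemma numeral_mem: "numeral n \<in> K"
  using of_nat_mem[of "numeral n"] by simp

lemma divide_mem: "a \<in> K \<Longrightarrow> b \<in> K \<Longrightarrow> a / b \<in> K"
  by (simp add: divide_inverse mult_mem inverse_mem)

lemmas mem_intros =
  zero_mem one_mem add_mem diff_mem mult_mem uminus_mem divide_mem of_nat_mem numeral_mem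

lemma sum_mem: "(\<And>i. i \<in> J \<Longrightarrow> f i \<in> K) \<Longrightarrow> sum f J \<in> K"
  by (induction J rule: infinite_finite_induct) (simp_all add: add_mem)

text \<open>Coefficients of a product are nested \<open>Sum_any\<close> convolutions;
  \<open>mult_polys\<close> needs closure under sums in this form.\<close>

lemma Sum_any_mem: "(\<And>i. f i \<in> K) \<Longrightarrow> Sum_any f \<in> K"
  by (simp add: Sum_any.expand_set sum_mem)

abbreviation polys :: "'v set \<Rightarrow> 'v mpoly set" where
  "polys U \<equiv> carrier (mpoly_ring K U)"

lemma mem_polys:
  "p \<in> polys U \<longleftrightarrow> (\<forall>m. Poly_Mapping.lookup p m \<in> K) \<and>
     (\<forall>m \<in> Poly_Mapping.keys p. Poly_Mapping.keys m \<subseteq> U)"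
  by (simp add: mpoly_ring_def)

lemma Const_polys: "c \<in> K \<Longrightarrow> Const c \<in> polys U"
  by (simp add: mem_polys Const_def lookup_single when_def)

lemma Var_polys: "v \<in> U \<Longrightarrow> Var v \<in> polys U"
  by (simp add: mem_polys Var_def lookup_single when_def)

lemma add_polys: "p \<in> polys U \<Longrightarrow> q \<in> polys U \<Longrightarrow> p + q \<in> polys U"
  using keys_add[of p q] by (fastforce simp: mem_polys lookup_add add_mem)

lemma mult_polys:
  assumes "p \<in> polys U" "q \<in> polys U" shows "p * q \<in> polys U"
proof -
  have "Poly_Mapping.lookup (p * q) m \<in> K" for m
    using assms by (auto simp: mem_polys lookup_mult when_def intro!: Sum_any_mem mult_mem)
  moreover have "Poly_Mapping.keys m \<subseteq> U" if m: "m \<in> Poly_Mapping.keys (p * q)" for m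
  proof -
    obtain a b where "m = a + b" "a \<in> Poly_Mapping.keys p" "b \<in> Poly_Mapping.keys q"
      using subsetD[OF keys_mult m] by blast
    then show ?thesis
      using assms keys_add[of a b] unfolding mem_polys by blast
  qed
  ultimately show ?thesis by (simp add: mem_polys)
qed

lemma zero_polys: "0 \<in> polys U" and one_polys: "1 \<in> polys U"
  using Const_polys[of 0] Const_polys[of 1] by simp_all

lemma numeral_polys: "numeral n \<in> polys U"
  using Const_polys[of "numeral n"] by (simp add: numeral_mem Const_numeral)

lemma diff_polys: "p \<in> polys U \<Longrightarrow> q \<in> polys U \<Longrightarrow> p - q \<in> polys U"
  using keys_diff[of p q] by (fastforce simp: mem_polys lookup_minus diff_mem)

lemma sum_polys: "(\<And>i. i \<in> J \<Longrightarrow> f i \<in> polys U) \<Longrightarrow> sum f J \<in> polys U"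
  by (induction J rule: infinite_finite_induct) (simp_all add: add_polys zero_polys)

lemma prod_polys: "(\<And>i. i \<in> J \<Longrightarrow> f i \<in> polys U) \<Longrightarrow> prod f J \<in> polys U"
  by (induction J rule: infinite_finite_induct) (simp_all add: mult_polys one_polys)

lemmas polys_intros =
  Const_polys Var_polys add_polys mult_polys zero_polys one_polys numeral_polys diff_polys sum_polys prod_polys

end

section \<open>Boolean ideals\<close>

locale boolean_ideal = real_subfield K for K +
  fixes U :: "'v set" and I :: "'v mpoly set"
  assumes finite_vars: "finite U"
    and ideal: "ideal I (mpoly_ring K U)"
    and boolean: "v \<in> U \<Longrightarrow> (Var v)\<^sup>2 - Var v \<in> I"
begin

lemma ideal_add: "p \<in> I \<Longrightarrow> q \<in> I \<Longrightarrow> p + q \<in> I"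
  and ideal_0: "0 \<in> I"
  and ideal_mult: "p \<in> polys U \<Longrightarrow> q \<in> I \<Longrightarrow> p * q \<in> I"
proof -
  have sub: "additive_subgroup I (mpoly_ring K U)"
    using ideal by (rule ideal.axioms)
  show "p \<in> I \<Longrightarrow> q \<in> I \<Longrightarrow> p + q \<in> I"
    using additive_subgroup.a_closed[OF sub, of p q] by (simp only: mpoly_ring_simps)
  show "0 \<in> I"
    using additive_subgroup.zero_closed[OF sub] by (simp only: mpoly_ring_simps)
  show "p \<in> polys U \<Longrightarrow> q \<in> I \<Longrightarrow> p * q \<in> I"
    using ideal.I_l_closed[OF ideal, of q p] by (simp only: mpoly_ring_simps)
qed

lemma ideal_diff:
  assumes "p \<in> I" "q \<in> I" shows "p - q \<in> I"
  using ideal_add[OF assms(1) ideal_mult[OF Const_polys assms(2), of "-1"]]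
  by (simp add: Const_uminus uminus_mem)

lemma ideal_sum: "(\<And>i. i \<in> J \<Longrightarrow> f i \<in> I) \<Longrightarrow> sum f J \<in> I"
  by (induction J rule: infinite_finite_induct) (simp_all add: ideal_0 ideal_add)

text \<open>The Lagrange idempotent of the 0/1 point with support \<open>A\<close>.\<close>

definition point :: "'v set \<Rightarrow> 'v mpoly" where
  "point A = (\<Prod>v\<in>A. Var v) * (\<Prod>v\<in>U - A. 1 - Var v)"

lemma point_polys: "A \<subseteq> U \<Longrightarrow> point A \<in> polys U"
  by (auto simp: point_def intro!: polys_intros)

text \<open>Expand the product over \<open>U\<close> of \<open>Var v + (1 - Var v) = 1\<close>:
  choosing a summand for every variable amounts to choosing a subset \<open>A\<close>.\<close>

lemma sum_point: "(\<Sum>A\<in>Pow U. point A) = 1"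
  using prod_add[OF finite_vars, of Var "\<lambda>v. 1 - Var v"] by (simp add: point_def)

text \<open>
  \<open>q\<close> has value \<open>c\<close> at the 0/1 point with support \<open>A\<close>, expressed inside the ring: \<open>q \<equiv> c\<close> modulo \<open>I\<close>
  after multiplication by the idempotent of \<open>A\<close>. This avoids an evaluation homomorphism.
\<close>

definition evaluates :: "'v set \<Rightarrow> 'v mpoly \<Rightarrow> real \<Rightarrow> bool" where
  "evaluates A q c \<longleftrightarrow> A \<subseteq> U \<and> q \<in> polys U \<and> c \<in> K \<and> (q - Const c) * point A \<in> I"

lemma evaluates_Const: "A \<subseteq> U \<Longrightarrow> c \<in> K \<Longrightarrow> evaluates A (Const c) c"
  by (simp add: evaluates_def ideal_0 Const_polys)

lemma evaluates_0: "A \<subseteq> U \<Longrightarrow> evaluates A 0 0" and evaluates_1: "A \<subseteq> U \<Longrightarrow> evaluates A 1 1"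
  using evaluates_Const[of A 0] evaluates_Const[of A 1] by simp_all

lemma evaluates_numeral: "A \<subseteq> U \<Longrightarrow> evaluates A (numeral n) (numeral n)"
  using evaluates_Const[of A "numeral n"] by (simp add: numeral_mem Const_numeral)

lemma evaluates_add:
  assumes "evaluates A p c" "evaluates A q d" shows "evaluates A (p + q) (c + d)"
proof -
  have "(p + q - Const (c + d)) * point A = (p - Const c) * point A + (q - Const d) * point A"
    by (simp add: Const_add algebra_simps)
  then show ?thesis
    using assms by (simp add: evaluates_def add_polys add_mem ideal_add)
qed

text \<open>Follows from \<open>p q - c d = p (q - d) + d (p - c)\<close>.\<close>

lemma evaluates_mult:
  assumes "evaluates A p c" "evaluates A q d" shows "evaluates A (p * q) (c * d)"
proof -
  have "(p * q - Const (c * d)) * point A =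
      p * ((q - Const d) * point A) + Const d * ((p - Const c) * point A)"
    by (simp add: Const_mult algebra_simps)
  then show ?thesis
    using assms
    by (simp add: evaluates_def mult_polys mult_mem ideal_add ideal_mult Const_polys)
qed

lemma evaluates_diff:
  assumes "evaluates A p c" "evaluates A q d" shows "evaluates A (p - q) (c - d)"
  using evaluates_add[OF assms(1) evaluates_mult[OF evaluates_Const assms(2), of "-1"]] assms
  by (simp add: Const_uminus uminus_mem evaluates_def)

lemma evaluates_power2: "evaluates A p c \<Longrightarrow> evaluates A (p\<^sup>2) (c\<^sup>2)"
  by (simp add: power2_eq_square evaluates_mult)

lemma evaluates_sum:
  "A \<subseteq> U \<Longrightarrow> (\<And>i. i \<in> J \<Longrightarrow> evaluates A (f i) (c i)) \<Longrightarrow> evaluates A (sum f J) (sum c J)"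
  by (induction J rule: infinite_finite_induct) (simp_all add: evaluates_0 evaluates_add)

lemma evaluates_prod:
  "A \<subseteq> U \<Longrightarrow> (\<And>i. i \<in> J \<Longrightarrow> evaluates A (f i) (c i)) \<Longrightarrow> evaluates A (prod f J) (prod c J)"
  by (induction J rule: infinite_finite_induct) (simp_all add: evaluates_1 evaluates_mult)

text \<open>\<open>point A\<close> has the factor \<open>Var v\<close> or \<open>1 - Var v\<close>
  according to whether \<open>v\<close> lies in \<open>A\<close>; multiplying it by
  \<open>Var v\<close> minus the value leaves a multiple of
  \<open>(Var v)\<^sup>2 - Var v\<close>.\<close>

lemma evaluates_Var:
  assumes "A \<subseteq> U" "v \<in> U" shows "evaluates A (Var v) (of_bool (v \<in> A))"
proof -
  have fin: "finite A" "finite (U - A)"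
    using assms finite_vars by (auto intro: finite_subset)
  have "(Var v - Const (of_bool (v \<in> A))) * point A \<in> I"
  proof (cases "v \<in> A")
    case True
    define r where "r = (\<Prod>v\<in>A - {v}. Var v) * (\<Prod>v\<in>U - A. 1 - Var v)"
    have "point A = Var v * r"
      using True fin by (simp add: point_def r_def prod.remove algebra_simps)
    then have "(Var v - Const (of_bool (v \<in> A))) * point A = r * ((Var v)\<^sup>2 - Var v)"
      using True by (simp add: algebra_simps power2_eq_square)
    moreover have "r \<in> polys U"
      using assms by (auto simp: r_def intro!: polys_intros)
    ultimately show ?thesis
      using ideal_mult boolean assms by simp
  next
    case False
    define r where "r = (\<Prod>v\<in>A. Var v) * (\<Prod>v\<in>U - A - {v}. 1 - Var v)"
    have "point A = (1 - Var v) * r"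
      using False assms fin by (simp add: point_def r_def prod.remove[of "U - A" v] algebra_simps)
    then have "(Var v - Const (of_bool (v \<in> A))) * point A = 0 - r * ((Var v)\<^sup>2 - Var v)"
      using False by (simp only: of_bool_eq Const_0) (simp add: algebra_simps power2_eq_square)
    moreover have "r \<in> polys U"
      using assms by (auto simp: r_def intro!: polys_intros)
    ultimately show ?thesis
      using ideal_diff[OF ideal_0 ideal_mult] boolean assms by simp
  qed
  then show ?thesis
    using assms by (simp add: evaluates_def Var_polys)
qed

lemmas evaluates_intros =
  evaluates_Const evaluates_0 evaluates_1 evaluates_numeral evaluates_add evaluates_mult
  evaluates_diff evaluates_power2 evaluates_sum evaluates_prod

text \<open>Values form a relation: they are not unique when \<open>point A\<close> itself lies in
  \<open>I\<close>. Quantifying over all \<open>c\<close> excludes such \<open>A\<close>, since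
  there \<open>0\<close> also has the value \<open>1\<close>.\<close>

definition vanishing_point :: "'v set \<Rightarrow> bool" where
  "vanishing_point A \<longleftrightarrow> A \<subseteq> U \<and> (\<forall>q\<in>I. \<forall>c. evaluates A q c \<longrightarrow> c = 0)"

lemma vanishing_pointD: "vanishing_point A \<Longrightarrow> q \<in> I \<Longrightarrow> evaluates A q c \<Longrightarrow> c = 0"
  by (auto simp: vanishing_point_def)

text \<open>By \<open>sum_point\<close>, \<open>p\<close> is the sum of the
  \<open>p * point A\<close>. At vanishing points these lie in \<open>I\<close> by hypothesis; at
  all others the idempotent itself lies in \<open>I\<close>.\<close>

theorem boolean_nullstellensatz:
  assumes p: "p \<in> polys U" and vanishes: "\<And>A. vanishing_point A \<Longrightarrow> evaluates A p 0"
  shows "p \<in> I"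
proof -
  have "p * point A \<in> I" if A: "A \<subseteq> U" for A
  proof (cases "vanishing_point A")
    case True
    then show ?thesis using vanishes by (simp add: evaluates_def)
  next
    case False
    then obtain q c where q: "q \<in> I" "evaluates A q c" "c \<noteq> 0"
      using A by (auto simp: vanishing_point_def)
    \<comment> \<open>The difference equals \<open>Const c * point A\<close>. As \<open>c\<close> is
      a nonzero element of a field, it can then be cancelled inside \<open>K[U]\<close>.\<close>
    have "point A * q - (q - Const c) * point A \<in> I"
      using q A by (simp add: evaluates_def ideal_diff ideal_mult point_polys)
    then have "Const c * point A \<in> I"
      by (simp add: algebra_simps)
    moreover have "p * Const (inverse c) \<in> polys U"
      using p q by (auto simp: evaluates_def intro!: polys_intros inverse_mem)
    ultimately have "p * Const (inverse c) * (Const c * point A) \<in> I"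
      using ideal_mult by blast
    moreover have "p * Const (inverse c) * (Const c * point A) = p * Const (inverse c * c) * point A"
      by (simp only: Const_mult mult.assoc)
    ultimately show ?thesis using q by simp
  qed
  then have "(\<Sum>A\<in>Pow U. p * point A) \<in> I"
    by (intro ideal_sum) auto
  then show ?thesis
    by (simp add: sum_point flip: sum_distrib_left)
qed

end

section \<open>Graphs with a single edge\<close>

text \<open>\<open>E\<close> is any set of sets, tested only on distinct pairs from
  \<open>V\<close>, so it may be the edge set of a graph or be read off from the edge variables in a
  Boolean point.\<close>

definition single_edge :: "'a set \<Rightarrow> 'a set set \<Rightarrow> 'a \<Rightarrow> 'a \<Rightarrow> bool" where
  "single_edge V E a b \<longleftrightarrow> a \<in> V \<and> b \<in> V \<and> a \<noteq> b \<and>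
     (\<forall>u\<in>V. \<forall>v\<in>V. u \<noteq> v \<longrightarrow> ({u, v} \<in> E \<longleftrightarrow> {u, v} = {a, b}))"

text \<open>\<open>D\<close> misses exactly one vertex, and its neighbour in \<open>D\<close> gives
  an edge. Given a second edge, two vertices could be left out with the rest still dominating,
  contrary to \<open>nodom\<close>.\<close>

lemma single_edgeI:
  assumes V: "finite V" "card V \<ge> 2"
    and D: "D \<subseteq> V" "card D = card V - 1"
    and dom: "\<And>v. v \<in> V - D \<Longrightarrow> \<exists>u\<in>D. {u, v} \<in> E"
    and nodom: "\<And>S. S \<subseteq> V \<Longrightarrow> card S = card D - 1 \<Longrightarrow> \<exists>v\<in>V - S. \<forall>u\<in>S. {u, v} \<notin> E"
  shows "\<exists>a b. single_edge V E a b"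
proof -
  have "D \<noteq> V" using V D by auto
  then obtain b where b: "b \<in> V - D" using D by blast
  then obtain a where a: "a \<in> D" "{a, b} \<in> E" using dom by blast
  \<comment> \<open>Otherwise the \<open>card V - 2\<close> vertices other than \<open>p\<close> and
    \<open>q\<close> would dominate. The neighbours \<open>w\<close> and \<open>w'\<close> may
    coincide.\<close>
  have no: False
    if "p \<in> V" "q \<in> V" "p \<noteq> q" "{w, p} \<in> E" "{w', q} \<in> E" "w \<in> V" "w' \<in> V"
      "w \<noteq> p" "w \<noteq> q" "w' \<noteq> p" "w' \<noteq> q" for p q w w'
  proof -
    have "card (V - {p, q}) = card D - 1"
      using V D that by (simp add: card_Diff_subset)
    from nodom[OF _ this] obtain v where "v \<in> {p, q}" "\<forall>u\<in>V - {p, q}. {u, v} \<notin> E"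
      using that by blast
    then show False using that by (metis Diff_iff empty_iff insert_iff)
  qed
  have "{u, v} = {a, b}" if uv: "u \<in> V" "v \<in> V" "u \<noteq> v" "{u, v} \<in> E" for u v
  proof (rule ccontr)
    assume ne: "{u, v} \<noteq> {a, b}"
    have ab: "a \<in> V" "b \<in> V" "a \<noteq> b" using a b D by auto
    have sym: "{b, a} \<in> E" "{v, u} \<in> E"
      using a(2) uv(4) by (metis insert_commute)+
    \<comment> \<open>If the two edges share an endpoint, the two other ends are dropped; if they
      are disjoint, one end of each is dropped.\<close>
    consider "u = a" "v \<noteq> b" | "u = b" "v \<noteq> a" | "v = a" "u \<noteq> b" | "v = b" "u \<noteq> a"
      | "u \<noteq> a" "u \<noteq> b" "v \<noteq> a" "v \<noteq> b" using ne by blast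
    then show False
    proof cases
      case 1 then show ?thesis using no[of v b a a] uv ab sym a(2) by simp
    next
      case 2 then show ?thesis using no[of v a b b] uv ab sym a(2) by simp
    next
      case 3 then show ?thesis using no[of u b a a] uv ab sym a(2) by simp
    next
      case 4 then show ?thesis using no[of u a b b] uv ab sym a(2) by simp
    next
      case 5 then show ?thesis using no[of v b u a] uv ab sym a(2) by simp
    qed
  qed
  moreover have "{u, v} \<in> E" if "{u, v} = {a, b}" for u v
    unfolding that by (rule a(2))
  ultimately have "\<forall>u\<in>V. \<forall>v\<in>V. u \<noteq> v \<longrightarrow> ({u, v} \<in> E \<longleftrightarrow> {u, v} = {a, b})"
    by (intro ballI impI iffI)
  moreover have "a \<in> V" "b \<in> V" "a \<noteq> b" using a b D by auto
  ultimately show ?thesis by (auto simp only: single_edge_def)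
qed

section \<open>The certificate at a point of the variety\<close>

text \<open>The certificate as an identity of real numbers, used both at points of the variety and
  for actual dominating sets. \<open>t g\<close> counts the chosen vertices in the fibre over
  \<open>g\<close>, \<open>q g\<close> the pairs of them.\<close>

lemma sos_identity:
  fixes x :: "'g \<Rightarrow> 'h \<Rightarrow> bool" and t q :: "'g \<Rightarrow> real"
  assumes V: "finite V" "single_edge V E a b"
    and W: "card W = 3" "single_edge W F c d"
    and dom: "\<And>g h. g \<in> V \<Longrightarrow> h \<in> W \<Longrightarrow> x g h \<or>
      (\<exists>g'\<in>V - {g}. {g, g'} \<in> E \<and> x g' h) \<or> (\<exists>h'\<in>W - {h}. {h, h'} \<in> F \<and> x g h')"
  defines "t \<equiv> \<lambda>g. \<Sum>h\<in>W. of_bool (x g h)"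
    and "q \<equiv> \<lambda>g. \<Sum>T | T \<subseteq> W \<and> card T = 2. \<Prod>h\<in>T. of_bool (x g h)"
  shows "(\<Sum>g\<in>V. t g) - (real (card V) - 1) * 2 =
    (sqrt 2 * (real (card V) - 1) + - (2 / 3) * sqrt 2 * (\<Sum>g\<in>V. t g)
       + 1 / 3 * sqrt 2 * (\<Sum>g\<in>V. q g))\<^sup>2 + (\<Sum>g\<in>V. (1 / 3 * (t g - 2 * q g))\<^sup>2)"
proof -
  have ab: "a \<in> V" "b \<in> V" "a \<noteq> b"
    and E: "\<And>u v. u \<in> V \<Longrightarrow> v \<in> V \<Longrightarrow> u \<noteq> v \<Longrightarrow> {u, v} \<in> E \<longleftrightarrow> {u, v} = {a, b}"
    and cd: "c \<in> W" "d \<in> W" "c \<noteq> d"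
    and F: "\<And>u v. u \<in> W \<Longrightarrow> v \<in> W \<Longrightarrow> u \<noteq> v \<Longrightarrow> {u, v} \<in> F \<longleftrightarrow> {u, v} = {c, d}"
    using V W by (auto simp: single_edge_def)
  have "card (W - {c, d}) = 1" using W cd by (simp add: card_Diff_subset)
  \<comment> \<open>\<open>r\<close> is the isolated vertex of the graph on
    \<open>W\<close>.\<close>
  then obtain r where r: "W - {c, d} = {r}" by (rule card_1_singletonE)
  then have W_eq: "W = {c, d, r}" and rne: "r \<noteq> c" "r \<noteq> d" using cd by auto
  have pairs: "{T. T \<subseteq> W \<and> card T = 2} = {{c, d}, {c, r}, {d, r}}"
    using cd(3) rne by (auto simp: W_eq card_2_iff)
  have t: "t g = of_bool (x g c) + of_bool (x g d) + of_bool (x g r)" for g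
    using cd(3) rne by (simp add: t_def W_eq)
  have q: "q g = of_bool (x g c) * of_bool (x g d) + of_bool (x g c) * of_bool (x g r)
      + of_bool (x g d) * of_bool (x g r)" for g
    using cd(3) rne by (simp add: q_def pairs doubleton_eq_iff)
  have E': "{u, v} \<in> E \<longleftrightarrow> u = a \<and> v = b \<or> u = b \<and> v = a"
    if "u \<in> V" "v \<in> V" "u \<noteq> v" for u v
    unfolding E[OF that] by (rule doubleton_eq_iff)
  have F': "{u, v} \<in> F \<longleftrightarrow> u = c \<and> v = d \<or> u = d \<and> v = c"
    if "u \<in> W" "v \<in> W" "u \<noteq> v" for u v
    unfolding F[OF that] by (rule doubleton_eq_iff)
  have EV: "g = a \<and> x b h \<or> g = b \<and> x a h"
    if "g \<in> V" "\<exists>g'\<in>V - {g}. {g, g'} \<in> E \<and> x g' h" for g h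
    using that E' by blast
  have FW: "h = c \<and> x g d \<or> h = d \<and> x g c"
    if "h \<in> W" "\<exists>h'\<in>W - {h}. {h, h'} \<in> F \<and> x g h'" for g h
    using that F' by blast
  have dom': "x g h \<or> g = a \<and> x b h \<or> g = b \<and> x a h \<or> h = c \<and> x g d \<or> h = d \<and> x g c"
    if "g \<in> V" "h \<in> W" for g h
    using dom[OF that] EV[OF that(1)] FW[OF that(2)] by blast
  define R where "R = V - {a, b}"
  have split: "(\<Sum>g\<in>V. f g) = f a + f b + (\<Sum>g\<in>R. f g)" for f :: "'g \<Rightarrow> real"
  proof -
    have "V = insert a (insert b R)" "finite R" "a \<notin> insert b R" "b \<notin> R"
      using V ab by (auto simp: R_def)
    then show ?thesis by simp
  qed
  have cardR: "real (card R) = real (card V) - 2"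
    using V ab split[of "\<lambda>_. 1"] by simp
  \<comment> \<open>The vertex \<open>(g, r)\<close> has no neighbour in the product, so it is
    chosen; so is at least one of \<open>(g, c)\<close> and \<open>(g, d)\<close>. Hence
    \<open>(t g, q g)\<close> is \<open>(2, 1)\<close> or \<open>(3, 3)\<close>.\<close>
  have isolated: "q g = 2 * t g - 3 \<and> (1 / 3 * (t g - 2 * q g))\<^sup>2 = t g - 2" if "g \<in> R" for g
  proof -
    have "x g r" "x g c \<or> x g d"
      using that dom'[of g r] dom'[of g c] rne cd by (auto simp: R_def W_eq)
    then show ?thesis unfolding t q by (auto simp: power2_eq_square)
  qed
  have Q: "(\<Sum>g\<in>R. q g) = 2 * (\<Sum>g\<in>R. t g) - 3 * (real (card V) - 2)"
    using isolated by (simp add: sum_subtractf sum_distrib_left cardR)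
  have S: "(\<Sum>g\<in>R. (1 / 3 * (t g - 2 * q g))\<^sup>2) = (\<Sum>g\<in>R. t g) - 2 * (real (card V) - 2)"
  proof -
    have "(\<Sum>g\<in>R. (1 / 3 * (t g - 2 * q g))\<^sup>2) = (\<Sum>g\<in>R. t g - 2)"
      using isolated by (intro sum.cong) blast+
    then show ?thesis by (simp add: sum_subtractf cardR)
  qed
  \<comment> \<open>These are the closed neighbourhoods of the product vertices over the edge of
    \<open>V\<close>; those of \<open>(a, r)\<close> and \<open>(b, r)\<close> agree, so five
    conditions cover six vertices.\<close>
  have "x a r \<or> x b r" "x a c \<or> x b c \<or> x a d" "x a d \<or> x b d \<or> x a c"
    "x b c \<or> x a c \<or> x b d" "x b d \<or> x a d \<or> x b c"
    using dom'[of a r] dom'[of a c] dom'[of a d] dom'[of b c] dom'[of b d] ab cd rne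
    by (auto simp: W_eq)
  then have edge: "t a + t b - 2 = 2 * (1 - 2 / 3 * (t a + t b) + 1 / 3 * (q a + q b))\<^sup>2
      + (1 / 3 * (t a - 2 * q a))\<^sup>2 + (1 / 3 * (t b - 2 * q b))\<^sup>2"
    unfolding t q
    by (cases "x a c"; cases "x a d"; cases "x a r"; cases "x b c"; cases "x b d"; cases "x b r")
      (simp_all add: power2_eq_square)
  \<comment> \<open>Each of the \<open>card V - 2\<close> isolated fibres contributes
    \<open>- 2/3 * t g + 1/3 * q g = -1\<close> inside the factor \<open>sqrt 2\<close>, which
    reduces \<open>card V - 1\<close> to \<open>1\<close>.\<close>
  have "sqrt 2 * (real (card V) - 1) + - (2 / 3) * sqrt 2 * (\<Sum>g\<in>V. t g)
       + 1 / 3 * sqrt 2 * (\<Sum>g\<in>V. q g) =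
      sqrt 2 * (1 - 2 / 3 * (t a + t b) + 1 / 3 * (q a + q b))"
    unfolding split[of t] split[of q] Q
    by (simp add: algebra_simps add_divide_distrib diff_divide_distrib)
  moreover have "(sqrt 2 * z)\<^sup>2 = 2 * z\<^sup>2" for z
    by (simp add: power_mult_distrib)
  ultimately show ?thesis
    using edge by (simp only: split[of t] split[of "\<lambda>g. (1 / 3 * (t g - 2 * q g))\<^sup>2"] S) simp
qed

section \<open>Vizing's inequality from the certificate\<close>

text \<open>The whole vertex set dominates, so \<open>Min\<close> ranges over a nonempty finite set
  and is attained.\<close>

lemma domination_number_props:
  assumes "simple_graph G"
  shows "\<exists>D. dominating_set G D \<and> card D = domination_number G"
    and "dominating_set G S \<Longrightarrow> domination_number G \<le> card S"
proof -
  have fin: "finite {D. dominating_set G D}"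
    by (rule finite_subset[of _ "Pow (vertices G)"])
      (use assms in \<open>auto simp: dominating_set_def simple_graph_def\<close>)
  moreover have "dominating_set G (vertices G)"
    by (simp add: dominating_set_def)
  ultimately have "domination_number G \<in> card ` {D. dominating_set G D}"
    unfolding domination_number_def by (intro Min_in) auto
  then show "\<exists>D. dominating_set G D \<and> card D = domination_number G" by auto
  show "dominating_set G S \<Longrightarrow> domination_number G \<le> card S"
    unfolding domination_number_def using fin by (intro Min_le) auto
qed

lemma single_edge_of_domination_number:
  assumes G: "simple_graph G" and n: "card (vertices G) \<ge> 2"
    and dn: "domination_number G = card (vertices G) - 1"
  shows "\<exists>a b. single_edge (vertices G) (edges G) a b"
proof -
  obtain D where D: "dominating_set G D" "card D = card (vertices G) - 1"
    using domination_number_props(1)[OF G] dn by auto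
  show ?thesis
  proof (rule single_edgeI[OF _ n _ D(2)])
    show "finite (vertices G)" using G by (simp add: simple_graph_def)
    show "D \<subseteq> vertices G" "\<And>v. v \<in> vertices G - D \<Longrightarrow> \<exists>u\<in>D. {u, v} \<in> edges G"
      using D by (auto simp: dominating_set_def)
    show "\<exists>v\<in>vertices G - S. \<forall>u\<in>S. {u, v} \<notin> edges G"
      if "S \<subseteq> vertices G" "card S = card D - 1" for S
    proof (rule ccontr)
      assume "\<not> ?thesis"
      then have "dominating_set G S" using that by (auto simp: dominating_set_def)
      \<comment> \<open>By \<open>n\<close>, \<open>card D\<close> is positive, so the truncated
        difference \<open>card D - 1\<close> really lies below the domination number.\<close>
      then show False using domination_number_props(2)[OF G] that D dn n by fastforce
    qed
  qed
qed

text \<open>Makes the domination number of the product an attained minimum. Product edges have two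
  distinct ends because the factors have no loops.\<close>

lemma simple_graph_cartesian_product:
  assumes G: "simple_graph G" and H: "simple_graph H"
  shows "simple_graph (cartesian_product G H)"
proof -
  have G': "u \<in> vertices G \<and> v \<in> vertices G \<and> u \<noteq> v" if "{u, v} \<in> edges G" for u v
  proof -
    have "{u, v} \<subseteq> vertices G \<and> card {u, v} = 2" using G that unfolding simple_graph_def by blast
    then show ?thesis by (auto simp: card_insert_if split: if_splits)
  qed
  have H': "u \<in> vertices H \<and> v \<in> vertices H \<and> u \<noteq> v" if "{u, v} \<in> edges H" for u v
  proof -
    have "{u, v} \<subseteq> vertices H \<and> card {u, v} = 2" using H that unfolding simple_graph_def by blast
    then show ?thesis by (auto simp: card_insert_if split: if_splits)
  qed
  have "e \<subseteq> vertices G \<times> vertices H \<and> card e = 2" if e: "e \<in> edges (cartesian_product G H)" for e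
  proof -
    consider g h h' where "e = {(g, h), (g, h')}" "g \<in> vertices G" "{h, h'} \<in> edges H"
      | g g' h where "e = {(g, h), (g', h)}" "{g, g'} \<in> edges G" "h \<in> vertices H"
      using e by (auto simp: cartesian_product_def)
    then show ?thesis
    proof cases
      case 1
      with H'[OF 1(3)] show ?thesis by simp
    next
      case 2
      with G'[OF 2(2)] show ?thesis by simp
    qed
  qed
  then show ?thesis using G H unfolding simple_graph_def by (simp add: cartesian_product_def)
qed

text \<open>Applied to the indicator of a minimum dominating set \<open>Z\<close> of the product,
  \<open>sos_identity\<close> writes \<open>card Z - 2 * (card (vertices G) - 1)\<close> as a sum of
  squares.\<close>

lemma vizing_inequality:
  assumes G: "simple_graph G" "card (vertices G) \<ge> 2" "domination_number G = card (vertices G) - 1"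
    and H: "simple_graph H" "card (vertices H) = 3" "domination_number H = 2"
  shows "domination_number G * domination_number H \<le> domination_number (cartesian_product G H)"
proof -
  obtain a b where ab: "single_edge (vertices G) (edges G) a b"
    using single_edge_of_domination_number[OF G] by blast
  obtain c d where cd: "single_edge (vertices H) (edges H) c d"
    using single_edge_of_domination_number[of H] H by auto
  have fin: "finite (vertices G)" "finite (vertices H)"
    using G H by (auto simp: simple_graph_def)
  obtain Z where Z: "dominating_set (cartesian_product G H) Z"
    and card_Z: "card Z = domination_number (cartesian_product G H)"
    using domination_number_props(1)[OF simple_graph_cartesian_product[OF G(1) H(1)]] by blast
  have sub: "Z \<subseteq> vertices G \<times> vertices H"
    using Z by (auto simp: dominating_set_def cartesian_product_def)
  \<comment> \<open>Absence of loops ensures that a dominating neighbour differs from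
    \<open>(g, h)\<close>, as the index sets in \<open>sos_identity\<close> demand.\<close>
  have neG: "{u, u} \<notin> edges G" for u using G(1) by (auto simp: simple_graph_def)
  have neH: "{u, u} \<notin> edges H" for u using H(1) by (auto simp: simple_graph_def)
  have dom: "(g, h) \<in> Z \<or> (\<exists>g'\<in>vertices G - {g}. {g, g'} \<in> edges G \<and> (g', h) \<in> Z) \<or>
      (\<exists>h'\<in>vertices H - {h}. {h, h'} \<in> edges H \<and> (g, h') \<in> Z)"
    if gh: "g \<in> vertices G" "h \<in> vertices H" for g h
  proof (cases "(g, h) \<in> Z")
    case False
    then have "(g, h) \<in> vertices (cartesian_product G H) - Z"
      using gh by (simp add: cartesian_product_def)
    then obtain g' h' where Z': "(g', h') \<in> Z"
      and e: "{(g', h'), (g, h)} \<in> edges (cartesian_product G H)"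
      using Z unfolding dominating_set_def by fast
    consider k l l' where "{(g', h'), (g, h)} = {(k, l), (k, l')}" "{l, l'} \<in> edges H"
      | k k' l where "{(g', h'), (g, h)} = {(k, l), (k', l)}" "{k, k'} \<in> edges G"
      using e by (auto simp: cartesian_product_def)
    then consider "g' = g" "{h, h'} \<in> edges H" | "h' = h" "{g, g'} \<in> edges G"
      unfolding doubleton_eq_iff prod.inject by cases (metis insert_commute)+
    then show ?thesis
    proof cases
      case 1
      then have "h' \<noteq> h" using neH by auto
      then show ?thesis using 1 Z' sub by blast
    next
      case 2
      then have "g' \<noteq> g" using neG by auto
      then show ?thesis using 2 Z' sub by blast
    qed
  qed simp
  have "(\<Sum>g\<in>vertices G. \<Sum>h\<in>vertices H. of_bool ((g, h) \<in> Z)) = real (card Z)"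
  proof -
    have "(\<Sum>g\<in>vertices G. \<Sum>h\<in>vertices H. of_bool ((g, h) \<in> Z)) =
        (\<Sum>p\<in>vertices G \<times> vertices H. of_bool (p \<in> Z) :: real)"
      by (simp add: sum.cartesian_product case_prod_unfold)
    also have "\<dots> = real (card Z)"
      using fin sub by (simp add: sum_of_bool_eq Int_absorb1)
    finally show ?thesis .
  qed
  with sos_identity[where x = "\<lambda>g h. (g, h) \<in> Z", OF fin(1) ab H(2) cd dom]
  have "real (card Z) - (real (card (vertices G)) - 1) * 2 \<ge> 0"
    by (simp add: sum_nonneg)
  then show ?thesis
    using G(2,3) H(3) card_Z by (simp add: of_nat_diff)
qed

section \<open>Graphs read off from Boolean points\<close>

text \<open>At a vanishing point each generator becomes a real product equal to \<open>0\<close>, so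
  some factor is \<open>0\<close>. The two product families thus yield the two domination hypotheses
  of \<open>single_edgeI\<close>; \<open>e\<close> stays abstract to serve both graphs.\<close>

lemma (in boolean_ideal) single_edge_at_point:
  assumes A: "vanishing_point A"
    and V: "finite V" "card V \<ge> 2" and D: "D \<subseteq> V" "card D = card V - 1"
    and gens: "graph_gens e V D \<subseteq> I"
    and e: "\<And>u v. u \<in> V \<Longrightarrow> v \<in> V \<Longrightarrow> u \<noteq> v \<Longrightarrow> evaluates A (e u v) (of_bool ({u, v} \<in> E))"
  shows "\<exists>a b. single_edge V E a b"
proof (rule single_edgeI[OF V D])
  have AU: "A \<subseteq> U" using A by (simp add: vanishing_point_def)
  show "\<exists>u\<in>D. {u, v} \<in> E" if v: "v \<in> V - D" for v
  proof -
    have "(\<Prod>u\<in>D. 1 - e v u) \<in> I"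
      using gens v by (auto simp: graph_gens_def)
    moreover have "evaluates A (\<Prod>u\<in>D. 1 - e v u) (\<Prod>u\<in>D. 1 - of_bool ({v, u} \<in> E))"
      using v D by (intro evaluates_prod evaluates_diff evaluates_1 e AU) auto
    ultimately have "(\<Prod>u\<in>D. 1 - of_bool ({v, u} \<in> E) :: real) = 0"
      by (rule vanishing_pointD[OF A])
    then have "\<exists>u\<in>D. 1 - of_bool ({v, u} \<in> E) = (0::real)"
      by (simp only: prod_zero_iff[OF finite_subset[OF D(1) V(1)]])
    then obtain u where u: "u \<in> D" "{v, u} \<in> E"
      by (auto simp: of_bool_def split: if_splits)
    have "{u, v} \<in> E" using u(2) by (subst insert_commute)
    then show ?thesis using u(1) by (rule bexI)
  qed
  show "\<exists>v\<in>V - S. \<forall>u\<in>S. {u, v} \<notin> E" if S: "S \<subseteq> V" "card S = card D - 1" for S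
  proof -
    have "(\<Prod>v\<in>V - S. \<Sum>u\<in>S. e u v) \<in> I"
      using gens S by (auto simp: graph_gens_def)
    moreover have "evaluates A (\<Prod>v\<in>V - S. \<Sum>u\<in>S. e u v)
        (\<Prod>v\<in>V - S. \<Sum>u\<in>S. of_bool ({u, v} \<in> E))"
      using S by (intro evaluates_prod evaluates_sum e AU) auto
    ultimately have "(\<Prod>v\<in>V - S. \<Sum>u\<in>S. of_bool ({u, v} \<in> E) :: real) = 0"
      by (rule vanishing_pointD[OF A])
    then have "\<exists>v\<in>V - S. (\<Sum>u\<in>S. of_bool ({u, v} \<in> E)) = (0::real)"
      by (simp only: prod_zero_iff[OF finite_Diff[OF V(1)]])
    then obtain v where v: "v \<in> V - S" "(\<Sum>u\<in>S. of_bool ({u, v} \<in> E)) = (0::real)" ..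
    \<comment> \<open>The values are real and nonnegative, so a vanishing sum means that
      \<open>v\<close> has no neighbour in \<open>S\<close>.\<close>
    then have "\<forall>u\<in>S. of_bool ({u, v} \<in> E) = (0::real)"
      using sum_nonneg_eq_0_iff[OF finite_subset[OF S(1) V(1)], of "\<lambda>u. of_bool ({u, v} \<in> E) :: real"]
      by simp
    then show ?thesis using v(1) by auto
  qed
qed

section \<open>Points of the Vizing variety\<close>

lemma viz_varsI:
  "u \<in> VG \<Longrightarrow> v \<in> VG \<Longrightarrow> u \<noteq> v \<Longrightarrow> EG {u, v} \<in> viz_vars VG VH"
  "h \<in> VH \<Longrightarrow> k \<in> VH \<Longrightarrow> h \<noteq> k \<Longrightarrow> EH {h, k} \<in> viz_vars VG VH"
  "g \<in> VG \<Longrightarrow> h \<in> VH \<Longrightarrow> XV g h \<in> viz_vars VG VH"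
  by (simp_all add: viz_vars_def)

lemma viz_varsE:
  assumes "w \<in> viz_vars VG VH"
  obtains u v where "w = EG {u, v}" "u \<in> VG" "v \<in> VG" "u \<noteq> v"
    | h k where "w = EH {h, k}" "h \<in> VH" "k \<in> VH" "h \<noteq> k"
    | g h where "w = XV g h" "g \<in> VG" "h \<in> VH"
  using assms unfolding viz_vars_def by (auto simp: card_2_iff)

lemma finite_viz_vars:
  assumes "finite VG" "finite VH" shows "finite (viz_vars VG VH)"
proof (rule finite_subset)
  show "viz_vars VG VH \<subseteq> EG ` Pow VG \<union> EH ` Pow VH \<union> case_prod XV ` (VG \<times> VH)"
    by (auto simp: viz_vars_def)
qed (use assms in auto)

text \<open>Each of the three kinds of variables has its own family of Boolean generators.
  \<open>I\<close> is any ideal containing the generators, since \<open>genideal\<close> is the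
  intersection of all of these.\<close>

lemma boolean_ideal_viz:
  assumes "real_subfield K" "finite VG" "finite VH" "ideal I (viz_ring K VG VH)"
    and gens: "graph_gens eG VG DG \<union> graph_gens eH VH DH \<union> product_gens VG VH \<subseteq> I"
  shows "boolean_ideal K (viz_vars VG VH) I"
proof (intro boolean_ideal.intro boolean_ideal_axioms.intro)
  show "(Var w)\<^sup>2 - Var w \<in> I" if "w \<in> viz_vars VG VH" for w
    using that
  proof (cases rule: viz_varsE)
    case (1 u v)
    then have "(Var w)\<^sup>2 - Var w \<in> graph_gens eG VG DG" unfolding graph_gens_def by blast
    then show ?thesis using gens by blast
  next
    case (2 h k)
    then have "(Var w)\<^sup>2 - Var w \<in> graph_gens eH VH DH" unfolding graph_gens_def by blast
    then show ?thesis using gens by blast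
  next
    case (3 g h)
    then have "(Var w)\<^sup>2 - Var w \<in> product_gens VG VH" unfolding product_gens_def by blast
    then show ?thesis using gens by blast
  qed
qed (use assms finite_viz_vars in \<open>simp_all add: viz_ring_def\<close>)

text \<open>The three blocks of the generator vanish when \<open>(g, h)\<close> is chosen, is
  dominated along \<open>VG\<close>, or is dominated along \<open>VH\<close>, respectively.\<close>

lemma domination_at_point:
  assumes bool_ideal: "boolean_ideal K (viz_vars VG VH) I"
    and A: "boolean_ideal.vanishing_point K (viz_vars VG VH) I A"
    and V: "finite VG" "finite VH" and gens: "product_gens VG VH \<subseteq> I"
    and gh: "g \<in> VG" "h \<in> VH"
  shows "XV g h \<in> A \<or> (\<exists>g'\<in>VG - {g}. EG {g, g'} \<in> A \<and> XV g' h \<in> A) \<or>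
    (\<exists>h'\<in>VH - {h}. EH {h, h'} \<in> A \<and> XV g h' \<in> A)"
proof -
  interpret boolean_ideal K "viz_vars VG VH" I by (rule bool_ideal)
  have AU: "A \<subseteq> viz_vars VG VH" using A by (simp add: vanishing_point_def)
  let ?b = "\<lambda>w. of_bool (w \<in> A) :: real"
  have "(1 - xv g h) * (\<Prod>g' \<in> VG - {g}. (1 - eG g g' * xv g' h))
      * (\<Prod>h' \<in> VH - {h}. (1 - eH h h' * xv g h')) \<in> I"
    using gens gh unfolding product_gens_def by blast
  moreover have "evaluates A ((1 - xv g h) * (\<Prod>g' \<in> VG - {g}. (1 - eG g g' * xv g' h))
      * (\<Prod>h' \<in> VH - {h}. (1 - eH h h' * xv g h')))
    ((1 - ?b (XV g h)) * (\<Prod>g' \<in> VG - {g}. (1 - ?b (EG {g, g'}) * ?b (XV g' h)))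
      * (\<Prod>h' \<in> VH - {h}. (1 - ?b (EH {h, h'}) * ?b (XV g h'))))"
    using gh by (intro evaluates_prod evaluates_diff evaluates_mult evaluates_1 evaluates_Var AU)
      (auto simp: viz_varsI)
  ultimately have "(1 - ?b (XV g h)) * (\<Prod>g' \<in> VG - {g}. (1 - ?b (EG {g, g'}) * ?b (XV g' h)))
      * (\<Prod>h' \<in> VH - {h}. (1 - ?b (EH {h, h'}) * ?b (XV g h'))) = 0"
    by (rule vanishing_pointD[OF A])
  then consider "1 - ?b (XV g h) = 0"
    | "(\<Prod>g' \<in> VG - {g}. (1 - ?b (EG {g, g'}) * ?b (XV g' h))) = 0"
    | "(\<Prod>h' \<in> VH - {h}. (1 - ?b (EH {h, h'}) * ?b (XV g h'))) = 0"
    by (auto simp only: mult_eq_0_iff)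
  then show ?thesis
  proof cases
    case 1 then show ?thesis by simp
  next
    case 2
    then have "\<exists>g'\<in>VG - {g}. 1 - ?b (EG {g, g'}) * ?b (XV g' h) = 0"
      by (simp only: prod_zero_iff[OF finite_Diff[OF V(1)]])
    then show ?thesis by (auto simp: of_bool_def split: if_splits)
  next
    case 3
    then have "\<exists>h'\<in>VH - {h}. 1 - ?b (EH {h, h'}) * ?b (XV g h') = 0"
      by (simp only: prod_zero_iff[OF finite_Diff[OF V(2)]])
    then show ?thesis by (auto simp: of_bool_def split: if_splits)
  qed
qed


section \<open>Membership in the ideal and degree of the certificate\<close>

text \<open>By \<open>boolean_nullstellensatz\<close> it suffices that the difference has value
  \<open>0\<close> at each vanishing point \<open>A\<close>; there \<open>sos_identity\<close>
  applies to the graphs and the vertex choice encoded by \<open>A\<close>.\<close>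

lemma sos_mem_ideal:
  fixes VG DG :: "'g set" and VH DH :: "'h set" and s0 :: "('g, 'h) viz_var mpoly"
  assumes bool_ideal: "boolean_ideal K (viz_vars VG VH) I" and sqrt2: "sqrt 2 \<in> K"
    and gens: "graph_gens eG VG DG \<union> graph_gens eH VH DH \<union> product_gens VG VH \<subseteq> I"
    and VG: "finite VG" "card VG \<ge> 2" and DG: "DG \<subseteq> VG" "card DG = card VG - 1"
    and VH: "finite VH" "card VH = 3" and DH: "DH \<subseteq> VH" "card DH = 2"
    and s0: "s0 = Const (sqrt 2 * (real (card VG) - 1))
                + Const (- (2 / 3) * sqrt 2) * (\<Sum>g\<in>VG. \<Sum>h\<in>VH. xv g h)
                + Const (1 / 3 * sqrt 2) * (\<Sum>g\<in>VG. \<Sum>T | T \<subseteq> VH \<and> card T = 2. \<Prod>h\<in>T. xv g h)"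
    and s: "\<And>g. g \<in> VG \<Longrightarrow>
              s g = Const (1 / 3) *
                ((\<Sum>h\<in>VH. xv g h) - 2 * (\<Sum>T | T \<subseteq> VH \<and> card T = 2. \<Prod>h\<in>T. xv g h))"
  shows "f_viz VG DG VH DH - (s0\<^sup>2 + (\<Sum>g\<in>VG. (s g)\<^sup>2)) \<in> I"
proof -
  interpret boolean_ideal K "viz_vars VG VH" I by (rule bool_ideal)
  define p where "p = f_viz VG DG VH DH - (s0\<^sup>2 + (\<Sum>g\<in>VG. (s g)\<^sup>2))"
  define t :: "'g \<Rightarrow> ('g, 'h) viz_var mpoly" where "t g = (\<Sum>h\<in>VH. xv g h)" for g
  define q :: "'g \<Rightarrow> ('g, 'h) viz_var mpoly"
    where "q g = (\<Sum>T | T \<subseteq> VH \<and> card T = 2. \<Prod>h\<in>T. xv g h)" for g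
  have p_eq: "p = (\<Sum>g\<in>VG. t g) - Const ((real (card VG) - 1) * 2) -
      ((Const (sqrt 2 * (real (card VG) - 1)) + Const (- (2 / 3) * sqrt 2) * (\<Sum>g\<in>VG. t g)
         + Const (1 / 3 * sqrt 2) * (\<Sum>g\<in>VG. q g))\<^sup>2
       + (\<Sum>g\<in>VG. (Const (1 / 3) * (t g - 2 * q g))\<^sup>2))"
    using VG DG DH by (simp add: p_def f_viz_def s0 s t_def q_def of_nat_diff)
  have "p \<in> polys (viz_vars VG VH)"
    unfolding p_eq t_def q_def power2_eq_square using sqrt2
    by (intro polys_intros mem_intros) (auto intro: viz_varsI)
  moreover have "evaluates A p 0" if A: "vanishing_point A" for A
  proof -
    have AU: "A \<subseteq> viz_vars VG VH" using A by (simp add: vanishing_point_def)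
    define x where "x g h \<longleftrightarrow> XV g h \<in> A" for g h
    define t' :: "'g \<Rightarrow> real" where "t' g = (\<Sum>h\<in>VH. of_bool (x g h))" for g
    define q' :: "'g \<Rightarrow> real"
      where "q' g = (\<Sum>T | T \<subseteq> VH \<and> card T = 2. \<Prod>h\<in>T. of_bool (x g h))" for g
    have t: "evaluates A (t g) (t' g)" if "g \<in> VG" for g
      unfolding t_def t'_def x_def using that
      by (intro evaluates_sum evaluates_Var AU) (auto intro: viz_varsI)
    have q: "evaluates A (q g) (q' g)" if "g \<in> VG" for g
      unfolding q_def q'_def x_def using that
      by (intro evaluates_sum evaluates_prod evaluates_Var AU) (auto intro: viz_varsI)
    obtain a b where ab: "single_edge VG {e. EG e \<in> A} a b"
      using single_edge_at_point[OF A VG DG, of eG "{e. EG e \<in> A}"] gens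
      by (auto intro!: evaluates_Var AU viz_varsI)
    obtain c d where cd: "single_edge VH {e. EH e \<in> A} c d"
      using single_edge_at_point[OF A VH(1) _ DH(1), of eH "{e. EH e \<in> A}"] VH DH gens
      by (auto intro!: evaluates_Var AU viz_varsI)
    have dom: "x g h \<or> (\<exists>g'\<in>VG - {g}. {g, g'} \<in> {e. EG e \<in> A} \<and> x g' h) \<or>
        (\<exists>h'\<in>VH - {h}. {h, h'} \<in> {e. EH e \<in> A} \<and> x g h')" if "g \<in> VG" "h \<in> VH" for g h
      using domination_at_point[OF bool_ideal A VG(1) VH(1) _ that] gens by (simp add: x_def)
    \<comment> \<open>The value is computed along the syntax of \<open>p_eq\<close>, with
      \<open>t'\<close> and \<open>q'\<close> as the values of the fibre sums.\<close>
    have "evaluates A p ((\<Sum>g\<in>VG. t' g) - (real (card VG) - 1) * 2 -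
        ((sqrt 2 * (real (card VG) - 1) + - (2 / 3) * sqrt 2 * (\<Sum>g\<in>VG. t' g)
           + 1 / 3 * sqrt 2 * (\<Sum>g\<in>VG. q' g))\<^sup>2
         + (\<Sum>g\<in>VG. (1 / 3 * (t' g - 2 * q' g))\<^sup>2)))"
      unfolding p_eq using sqrt2
      by (intro evaluates_intros mem_intros t q AU)
    then show ?thesis
      using sos_identity[OF VG(1) ab VH(2) cd dom, folded t'_def q'_def] by simp
  qed
  ultimately show ?thesis
    unfolding p_def by (rule boolean_nullstellensatz)
qed

text \<open>The sets \<open>T\<close> have two elements, so their products of variables have degree
  at most \<open>2\<close>; constant factors do not raise the bound.\<close>

lemma total_degree_certificate:
  fixes c c0 c1 c2 :: real and g :: 'g and VH :: "'h set"
  defines "t \<equiv> \<lambda>g. \<Sum>h\<in>VH. xv g h" and "q \<equiv> \<lambda>g. \<Sum>T | T \<subseteq> VH \<and> card T = 2. \<Prod>h\<in>T. xv g h"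
  shows "total_degree (Const c0 + Const c1 * sum t VG + Const c2 * sum q VG) \<le> 2"
    and "total_degree (Const c * (t g - 2 * q g)) \<le> 2"
proof -
  have const: "total_degree (Const c * p) \<le> 2" if "total_degree p \<le> 2" for c and p :: "('g, 'h) viz_var mpoly"
    using total_degree_mult_le[of "Const c" 0 p 2] that by simp
  have t: "total_degree (t g) \<le> 2" for g
    unfolding t_def
    by (intro total_degree_sum_le order_trans[OF total_degree_Var_le]) simp
  have q: "total_degree (q g) \<le> 2" for g
    unfolding q_def
  proof (rule total_degree_sum_le)
    fix T assume "T \<in> {T. T \<subseteq> VH \<and> card T = 2}"
    then show "total_degree (\<Prod>h\<in>T. xv g h :: ('g, 'h) viz_var mpoly) \<le> 2"
      using total_degree_prod_le[of T "xv g" 1, OF total_degree_Var_le] by simp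
  qed
  show "total_degree (Const c0 + Const c1 * sum t VG + Const c2 * sum q VG) \<le> 2"
    by (intro total_degree_add_le const total_degree_sum_le t q) simp
  have "total_degree (2 * q g) \<le> 2"
    using const[OF q, of 2] by (simp add: Const_numeral)
  then show "total_degree (Const c * (t g - 2 * q g)) \<le> 2"
    by (intro total_degree_diff_le const t)
qed

theorem theorem4p6:
  fixes K :: "real set"
    and VG DG :: "'g set" and VH DH :: "'h set"
    and nG kG nH kH :: nat
    and \<alpha> \<beta> \<gamma> :: real
    and s0 :: "('g, 'h) viz_var mpoly" and s :: "'g \<Rightarrow> ('g, 'h) viz_var mpoly"
  assumes K: "subfield K (ring_of_type_algebra :: real ring)" "sqrt 2 \<in> K"
    and VG: "finite VG" "card VG = nG" and DG: "DG \<subseteq> VG" "card DG = kG"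
    and VH: "finite VH" "card VH = nH" and DH: "DH \<subseteq> VH" "card DH = kH"
    and kG: "kG = nG - 1" "nG - 1 \<ge> 1"
    and nH: "nH = 3" and kH: "kH = 2"
    and \<alpha>: "\<alpha> = sqrt 2 * (real nG - 1)"
    and \<beta>: "\<beta> = - (2 / 3) * sqrt 2"
    and \<gamma>: "\<gamma> = 1 / 3 * sqrt 2"
    and s0: "s0 = Const \<alpha> + Const \<beta> * (\<Sum>g\<in>VG. \<Sum>h\<in>VH. xv g h)
                + Const \<gamma> * (\<Sum>g\<in>VG. \<Sum>T | T \<subseteq> VH \<and> card T = 2. \<Prod>h\<in>T. xv g h)"
    and s: "\<And>g. g \<in> VG \<Longrightarrow>
              s g = Const (1 / 3) *
                ((\<Sum>h\<in>VH. xv g h) - 2 * (\<Sum>T | T \<subseteq> VH \<and> card T = 2. \<Prod>h\<in>T. xv g h))"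
  shows "cong_mod (f_viz VG DG VH DH) (s0\<^sup>2 + (\<Sum>g\<in>VG. (s g)\<^sup>2)) (viz_ideal K VG DG VH DH)
    \<and> sos_certificate (viz_ring K VG VH) (viz_ideal K VG DG VH DH) 2 (f_viz VG DG VH DH)
        (insert None (Some ` VG)) (case_option s0 s)
    \<and> (\<forall>(G :: 'a ugraph) (H :: 'b ugraph).
         simple_graph G \<and> card (vertices G) = nG \<and> domination_number G = nG - 1 \<and>
         simple_graph H \<and> card (vertices H) = 3 \<and> domination_number H = 2 \<longrightarrow>
         domination_number G * domination_number H \<le> domination_number (cartesian_product G H))"
proof -
  interpret real_subfield K by (rule real_subfield.intro[OF K(1)])
  note s0 = s0[unfolded \<alpha> \<beta> \<gamma>]
  have cards: "card VG \<ge> 2" "card DG = card VG - 1" "card VH = 3" "card DH = 2"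
    using VG DG VH DH kG nH kH by auto
  \<comment> \<open>Unfolding \<open>genideal\<close> as an intersection reduces the claim to one
    arbitrary ideal containing the generators.\<close>
  have mem: "f_viz VG DG VH DH - (s0\<^sup>2 + (\<Sum>g\<in>VG. (s g)\<^sup>2)) \<in> viz_ideal K VG DG VH DH"
    unfolding viz_ideal_def genideal_def
  proof (rule InterI, clarify)
    fix I assume I: "ideal I (viz_ring K VG VH)"
      "graph_gens eG VG DG \<union> graph_gens eH VH DH \<union> product_gens VG VH \<subseteq> I"
    show "f_viz VG DG VH DH - (s0\<^sup>2 + (\<Sum>g\<in>VG. (s g)\<^sup>2)) \<in> I"
      by (rule sos_mem_ideal[OF boolean_ideal_viz[OF real_subfield_axioms VG(1) VH(1) I] K(2) I(2)
            VG(1) cards(1) DG(1) cards(2) VH(1) cards(3) DH(1) cards(4) s0[folded VG(2)] s])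
  qed
  have polys: "s0 \<in> polys (viz_vars VG VH)" "\<And>g. g \<in> VG \<Longrightarrow> s g \<in> polys (viz_vars VG VH)"
    using K(2) by (auto simp: s0 s intro!: polys_intros mem_intros viz_varsI)
  have degree: "total_degree s0 \<le> 2" "\<And>g. g \<in> VG \<Longrightarrow> total_degree (s g) \<le> 2"
    unfolding s0 using total_degree_certificate by (auto simp only: s)
  \<comment> \<open>\<open>None\<close> indexes \<open>s0\<close> and \<open>Some g\<close> indexes
    \<open>s g\<close>, which merges all squares into a single indexed sum.\<close>
  have "(\<Sum>i\<in>insert None (Some ` VG). (case_option s0 s i)\<^sup>2) = s0\<^sup>2 + (\<Sum>g\<in>VG. (s g)\<^sup>2)"
    using VG(1) by (subst sum.insert) (auto simp: sum.reindex)
  then have "sos_certificate (viz_ring K VG VH) (viz_ideal K VG DG VH DH) 2 (f_viz VG DG VH DH)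
        (insert None (Some ` VG)) (case_option s0 s)"
    using mem polys degree VG(1) by (auto simp: sos_certificate_def cong_mod_def viz_ring_def)
  moreover have "domination_number G * domination_number H \<le> domination_number (cartesian_product G H)"
    if "simple_graph G \<and> card (vertices G) = nG \<and> domination_number G = nG - 1 \<and>
         simple_graph H \<and> card (vertices H) = 3 \<and> domination_number H = 2"
    for G :: "'a ugraph" and H :: "'b ugraph"
    using that kG(2) by (intro vizing_inequality) auto
  ultimately show ?thesis
    using mem unfolding cong_mod_def by blast
qed

end
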